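(* Let $G=(V,E)$ be a finite quiver without self-loops, with $V=\{1,\dots,p\}$, let $n_v\ge1$ be integers for $v\in V$, $n=n_1+\cdots+n_p$, let $(x_e)_{e\in E}$ be complex numbers, and let $(U_e)_{e\in E}$ be complex matrices, $U_e$ of size $n_{s(e)}\times n_{t(e)}$. Let $\Delta$ be the associated twisted Laplacian. Then $$\det\Delta=\frac{1}{n_1!\cdots n_p!}\sum_{\xi\in\Xi}\underline{x}^{\xi}\left[\sum_{\sigma\in\Sigma(\xi)}\prod_{a=1}^p(n_a-v_a(\sigma))!\prod_{c\in C(\sigma)}-\operatorname{Tr}\operatorname{hol}(c)\right].$$
   Context: A finite quiver is a finite directed graph (multiple edges allowed); each edge $e$ goes from $s(e)$ to $t(e)$, and no self-loops means $s(e)\ne t(e)$ for all $e$. The twisted Laplacian is the endomorphism of $\bigoplus_{v\in V}\mathbb{C}^{n_v}$ given by $\Delta f(v)=\sum_{e\in E:\,s(e)=v}x_e\,[f(s(e))-U_ef(t(e))]$. Split $\{1,\dots,n\}$ into consecutive intervals $I_1,\dots,I_p$ of sizes $n_1,\dots,n_p$, and let $\mathsf{b}(i)$ be the index such that $i\in I_{\mathsf{b}(i)}$. Let $E_a=\{e\in E:s(e)=a\}$. $\Xi$ is the set of maps $\xi:\{1,\dots,n\}\to E$ such that $\xi(i)\in E_{\mathsf{b}(i)}$ for all $i$, and $\underline{x}^{\xi}=\prod_{i=1}^nx_{\xi(i)}$. For $\xi\in\Xi$, $\Sigma(\xi)$ is the set of permutations $\sigma$ of $\{1,\dots,n\}$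 such that for every $i$, either $\sigma(i)=i$ or $t(\xi(i))=\mathsf{b}(\sigma(i))$. For $\sigma\in\Sigma(\xi)$, $C(\sigma)$ is the set of cycles of $\sigma$ of length at least $2$; $v_a(\sigma)$ is the number of elements of $I_a$ that are not fixed by $\sigma$ (the total number of visits at $a$ of the cycles in $C(\sigma)$); and for $c=(i_1\cdots i_r)\in C(\sigma)$, $\operatorname{hol}(c)=U_{\xi(i_1)}\cdots U_{\xi(i_r)}$, whose trace does not depend on the starting point. *)

theory Defs
  imports
    "HOL-Combinatorics.Cycles"
    "Graph_Theory.Digraph"
    "Jordan_Normal_Form.Determinant"
begin

definition total_dim :: "nat \<Rightarrow> (nat \<Rightarrow> nat) \<Rightarrow> nat" where
  "total_dim p n = (\<Sum>v=1..p. n v)"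

definition interval :: "(nat \<Rightarrow> nat) \<Rightarrow> nat \<Rightarrow> nat set" where
  "interval n a = {(\<Sum>v=1..<a. n v) + 1 .. (\<Sum>v=1..<a. n v) + n a}"

definition block :: "(nat \<Rightarrow> nat) \<Rightarrow> nat \<Rightarrow> nat" where
  "block n i = (THE a. 1 \<le> a \<and> i \<in> interval n a)"

text \<open>
  Indices \<open>i \<in> {1..total_dim p n}\<close> are counted from 1, whereas the components of vectors and
  the entries of matrices are counted from 0.  An index \<open>i\<close> stands for the component
  \<open>position n i\<close> of the summand at the vertex \<open>block n i\<close>.
\<close>

definition position :: "(nat \<Rightarrow> nat) \<Rightarrow> nat \<Rightarrow> nat" where
  "position n i = i - 1 - (\<Sum>v=1..<block n i. n v)"

text \<open>
  An element of the direct sum of the spaces of dimension \<open>n v\<close> is a function \<open>f\<close> with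
  \<open>f v \<in> carrier_vec (n v)\<close> for every vertex \<open>v\<close>.
\<close>

definition twisted_laplacian ::
  "(nat, 'e) pre_digraph \<Rightarrow> (nat \<Rightarrow> nat) \<Rightarrow> ('e \<Rightarrow> complex) \<Rightarrow> ('e \<Rightarrow> complex mat)
    \<Rightarrow> (nat \<Rightarrow> complex vec) \<Rightarrow> nat \<Rightarrow> complex vec" where
  "twisted_laplacian G n x U f v =
    finsum_vec TYPE(complex) (n v)
      (\<lambda>e. x e \<cdot>\<^sub>v (f (tail G e) - U e *\<^sub>v f (head G e))) (out_arcs G v)"

definition basis_section :: "(nat \<Rightarrow> nat) \<Rightarrow> nat \<Rightarrow> nat \<Rightarrow> complex vec" where
  "basis_section n j v =
    (if v = block n j then unit_vec (n v) (position n j) else 0\<^sub>v (n v))"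

text \<open>
  The determinant of an endomorphism \<open>L\<close> of the direct sum over the vertices \<open>1, \<dots>, p\<close>, taken
  as the determinant of its matrix in the canonical basis: column \<open>j\<close> holds the coordinates of
  the image of the basis element of index \<open>j + 1\<close>.
\<close>

definition det_endo ::
  "nat \<Rightarrow> (nat \<Rightarrow> nat) \<Rightarrow> ((nat \<Rightarrow> complex vec) \<Rightarrow> nat \<Rightarrow> complex vec) \<Rightarrow> complex" where
  "det_endo p n L =
    det (mat (total_dim p n) (total_dim p n)
      (\<lambda>(i, j). L (basis_section n (j + 1)) (block n (i + 1)) $ position n (i + 1)))"

text \<open>The set \<open>\<Xi>\<close>; its members are \<open>undefined\<close> outside \<open>{1..total_dim p n}\<close>.\<close>

definition arc_choices ::
  "(nat, 'e) pre_digraph \<Rightarrow> nat \<Rightarrow> (nat \<Rightarrow> nat) \<Rightarrow> (nat \<Rightarrow> 'e) set" where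
  "arc_choices G p n = (\<Pi>\<^sub>E i\<in>{1..total_dim p n}. out_arcs G (block n i))"

text \<open>The set \<open>\<Sigma>(\<xi>)\<close>.\<close>

definition compatible_perms ::
  "(nat, 'e) pre_digraph \<Rightarrow> nat \<Rightarrow> (nat \<Rightarrow> nat) \<Rightarrow> (nat \<Rightarrow> 'e) \<Rightarrow> (nat \<Rightarrow> nat) set" where
  "compatible_perms G p n \<xi> =
    {\<sigma>. \<sigma> permutes {1..total_dim p n} \<and>
         (\<forall>i\<in>{1..total_dim p n}. \<sigma> i = i \<or> head G (\<xi> i) = block n (\<sigma> i))}"

text \<open>
  The set \<open>C(\<sigma>)\<close>.  Each cycle of length at least 2 is represented exactly once, namely by the list
  \<open>[i, \<sigma> i, \<sigma> (\<sigma> i), \<dots>]\<close> that starts at the least element \<open>i\<close> of the cycle.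
\<close>

definition nontrivial_cycles :: "(nat \<Rightarrow> nat) \<Rightarrow> nat list set" where
  "nontrivial_cycles \<sigma> = {support \<sigma> i | i. \<sigma> i \<noteq> i \<and> (\<forall>j\<in>set (support \<sigma> i). i \<le> j)}"

definition visits :: "(nat \<Rightarrow> nat) \<Rightarrow> (nat \<Rightarrow> nat) \<Rightarrow> nat \<Rightarrow> nat" where
  "visits n \<sigma> a = card {i \<in> interval n a. \<sigma> i \<noteq> i}"

text \<open>
  For \<open>c = [i\<^sub>1, \<dots>, i\<^sub>r]\<close> this is the product of \<open>U (\<xi> i\<^sub>1), \<dots>, U (\<xi> i\<^sub>r)\<close> in this order, a square
  matrix whose size is the dimension at the vertex \<open>block n i\<^sub>1\<close>.
\<close>

definition holonomy ::
  "(nat \<Rightarrow> nat) \<Rightarrow> ('e \<Rightarrow> complex mat) \<Rightarrow> (nat \<Rightarrow> 'e) \<Rightarrow> nat list \<Rightarrow> complex mat" where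
  "holonomy n U \<xi> c = foldr (\<lambda>i A. U (\<xi> i) * A) c (1\<^sub>m (n (block n (hd c))))"

definition mat_trace :: "complex mat \<Rightarrow> complex" where
  "mat_trace A = (\<Sum>k<dim_row A. A $$ (k, k))"

end

theory Submission
  imports Defs
begin

text \<open>
  Expanding every row of the determinant over the arcs that leave the corresponding vertex turns
  \<open>det \<Delta>\<close> into the sum over \<open>\<xi>\<close> of \<open>x\<^sup>\<xi> det (1 - A\<^sub>\<xi>)\<close>, where row \<open>i\<close> of \<open>A\<^sub>\<xi>\<close> is a row of the matrix
  \<open>U\<close> of the single arc \<open>\<xi> i\<close>.  Since there are no loops, \<open>A\<^sub>\<xi>\<close> has zero diagonal, and the Leibniz
  formula becomes a sum over the compatible permutations \<open>\<sigma>\<close> in which the fixed points contribute 1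
  (\<open>sum_compat_perm_weight\<close>).

  The index \<open>i\<close> plays two roles here: it carries the arc \<open>\<xi> i\<close>, and it names a basis vector of the
  space at its vertex.  The proof separates them.  A \<^emph>\<open>placement\<close> \<open>\<rho>\<close> assigns to each index a basis
  vector of its own block, injectively on each block.  Using \<open>\<rho> i\<close> instead of the position of \<open>i\<close>
  permutes rows and columns in the same way and does not change the determinant
  (\<open>det_endo_laplacian_placement\<close>).  As there are \<open>n\<^sub>1! \<cdots> n\<^sub>p!\<close> placements, averaging over all of
  them produces the factor in front of the sum.

  After averaging, the weight of \<open>\<sigma>\<close> depends on \<open>\<rho>\<close> only through the indices that \<open>\<sigma>\<close> moves.  A
  function \<open>g\<close> on those indices that is injective on each block extends to
  \<open>\<Prod>\<^sub>a (n\<^sub>a - v\<^sub>a)!\<close> placements (\<open>card_placement_extensions\<close>).  So it remains to compare the sum over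
  injective \<open>g\<close> with the sum over all \<open>g\<close>, which is the product of the traces of the holonomies, up to
  the signs (\<open>prod_cycle_traces\<close>).  The difference vanishes: if \<open>g\<close> takes the same value at two moved
  indices \<open>j\<close>, \<open>k\<close> of a block, then composing \<open>\<sigma>\<close> with the transposition of \<open>j\<close> and \<open>k\<close> changes neither
  the matrix entries nor the set of moved indices, but reverses the sign (\<open>sum_perm_weight_collision\<close>).
  All this happens for a fixed \<open>\<xi>\<close>.
\<close>

section \<open>Injective placements and their extensions\<close>

definition placements :: "'i set \<Rightarrow> ('i \<Rightarrow> 'v) \<Rightarrow> ('v \<Rightarrow> nat) \<Rightarrow> ('i \<Rightarrow> nat) set" where
  "placements S b d =
    {\<rho> \<in> (\<Pi>\<^sub>E i\<in>S. {..<d (b i)}). \<forall>i\<in>S. \<forall>j\<in>S. b i = b j \<longrightarrow> \<rho> i = \<rho> j \<longrightarrow> i = j}"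

lemma finite_placements: "finite S \<Longrightarrow> finite (placements S b d)"
  unfolding placements_def
  by (rule finite_subset[OF _ finite_PiE[of S "\<lambda>i. {..<d (b i)}"]]) auto

lemma restrict_placements:
  assumes "\<rho> \<in> placements I b d" "S \<subseteq> I"
  shows "restrict \<rho> S \<in> placements S b d"
  using assms(1) subsetD[OF assms(2)] unfolding placements_def by (auto simp: PiE_iff)

text \<open>
  The indices outside \<open>S\<close> receive their values one after another.  When an index of the block \<open>a\<close> is
  treated, its value must avoid the values already used in that block, which leaves
  \<open>d a - card {i\<in>S. b i = a}\<close> choices; the block has exactly \<open>d a\<close> indices, so these numbers run down to
  1 and their product is a factorial.
\<close>
lemma card_placement_extensions:
  assumes "finite I" and "finite A" and "b ` I \<subseteq> A"
    and full: "\<And>a. a \<in> A \<Longrightarrow> card {i\<in>I. b i = a} = d a"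
    and "S \<subseteq> I" and "g \<in> placements S b d"
  shows "card {\<rho> \<in> placements I b d. restrict \<rho> S = g} =
    (\<Prod>a\<in>A. fact (d a - card {i\<in>S. b i = a}))"
  using assms(5,6)
proof (induction "card (I - S)" arbitrary: S g)
  case 0
  then have "S = I"
    using assms(1) by auto
  have "{\<rho> \<in> placements I b d. restrict \<rho> S = g} = {g}"
    using 0 \<open>S = I\<close> by (auto simp: placements_def)
  then have "card {\<rho> \<in> placements I b d. restrict \<rho> S = g} = 1"
    by (metis One_nat_def card_1_singleton_iff)
  then show ?case
    using full \<open>S = I\<close> by (simp only: diff_self_eq_0 fact_0 prod.neutral_const cong: prod.cong)
next
  case (Suc m)
  then obtain t where t: "t \<in> I" "t \<notin> S"
    by (metis Diff_iff card.empty ex_in_conv nat.distinct(1))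
  have fin: "finite S"
    using Suc.prems assms(1) finite_subset by blast
  let ?used = "g ` {i\<in>S. b i = b t}"
  let ?free = "{..<d (b t)} - ?used"
  let ?ext = "\<lambda>S g. {\<rho> \<in> placements I b d. restrict \<rho> S = g}"
  \<comment> \<open>Values already used in the block of \<open>t\<close> are left out because no placement extends those choices.\<close>
  have split: "?ext S g = (\<Union>v\<in>?free. ?ext (insert t S) (g(t := v)))"
  proof (intro equalityI subsetI)
    fix \<rho> assume r: "\<rho> \<in> ?ext S g"
    then have "\<rho> t \<in> {..<d (b t)}"
      using t by (auto simp: placements_def)
    moreover have "\<rho> t \<notin> ?used"
    proof
      assume "\<rho> t \<in> ?used"
      then obtain i where i: "i \<in> S" "b i = b t" "\<rho> t = g i" by auto
      then have "\<rho> t = \<rho> i"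
        using r by (metis (mono_tags, lifting) mem_Collect_eq restrict_apply')
      then show False
        using i t r Suc.prems(1) by (force simp: placements_def)
    qed
    moreover have "restrict \<rho> (insert t S) = g(t := \<rho> t)"
      using r by (auto simp: fun_eq_iff restrict_def)
    ultimately show "\<rho> \<in> (\<Union>v\<in>?free. ?ext (insert t S) (g(t := v)))"
      using r by blast
  next
    fix \<rho> assume "\<rho> \<in> (\<Union>v\<in>?free. ?ext (insert t S) (g(t := v)))"
    then obtain v where r: "\<rho> \<in> placements I b d" "restrict \<rho> (insert t S) = g(t := v)"
      by blast
    have "g \<in> extensional S"
      using Suc.prems by (auto simp: placements_def PiE_iff)
    have "restrict \<rho> S = g"
    proof
      fix i show "restrict \<rho> S i = g i"
        using fun_cong[OF r(2), of i] t \<open>g \<in> extensional S\<close> by (auto simp: restrict_def extensional_def split: if_splits)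
    qed
    with r show "\<rho> \<in> ?ext S g" by simp
  qed
  have ins: "g(t := v) \<in> placements (insert t S) b d" if "v \<in> ?free" for v
  proof -
    have "g(t := v) \<in> (\<Pi>\<^sub>E i\<in>insert t S. {..<d (b i)})"
      using that Suc.prems by (intro PiE_fun_upd) (auto simp: placements_def)
    moreover have "(g(t := v)) i = (g(t := v)) j \<longrightarrow> i = j"
      if ij: "i \<in> insert t S" "j \<in> insert t S" "b i = b j" for i j
      using \<open>v \<in> ?free\<close> Suc.prems(2) t ij unfolding placements_def
      by (cases "i = t"; cases "j = t") auto
    ultimately show ?thesis
      unfolding placements_def by blast
  qed
  have card: "card (?ext (insert t S) (g(t := v))) =
      (\<Prod>a\<in>A. fact (d a - card {i\<in>insert t S. b i = a}))" if "v \<in> ?free" for v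
    using Suc.hyps(2) Suc.prems t ins[OF that] assms(1)
    by (intro Suc.hyps(1)) (auto simp: Diff_insert[symmetric] card_Diff_insert)
  have bt: "b t \<in> A" using assms(3) t by auto
  have "inj_on g {i\<in>S. b i = b t}"
    using Suc.prems by (auto simp: placements_def inj_on_def)
  moreover have "?used \<subseteq> {..<d (b t)}"
    using Suc.prems(2) unfolding placements_def by (auto dest!: PiE_mem)
  ultimately have cfree: "card ?free = d (b t) - card {i\<in>S. b i = b t}"
    using fin by (simp add: card_Diff_subset card_image)
  have "card (insert t {i\<in>S. b i = b t}) \<le> card {i\<in>I. b i = b t}"
    using t Suc.prems assms(1) by (intro card_mono) auto
  then have lt: "card {i\<in>S. b i = b t} < d (b t)"
    using full[OF bt] t fin by simp
  have "card (?ext S g) = (\<Sum>v\<in>?free. card (?ext (insert t S) (g(t := v))))"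
    unfolding split
  proof (rule card_UN_disjoint)
    show "\<forall>i\<in>?free. \<forall>j\<in>?free. i \<noteq> j \<longrightarrow> ?ext (insert t S) (g(t := i)) \<inter> ?ext (insert t S) (g(t := j)) = {}"
      by (auto dest: fun_upd_eqD)
  qed (use finite_placements[OF assms(1), of b d] in simp_all)
  also have "\<dots> = card ?free * (\<Prod>a\<in>A. fact (d a - card {i\<in>insert t S. b i = a}))"
    using card by simp
  also have "\<dots> = (\<Prod>a\<in>A. fact (d a - card {i\<in>S. b i = a}))"
  proof -
    have *: "{i\<in>insert t S. b i = b t} = insert t {i\<in>S. b i = b t}" by auto
    have "(\<Prod>a\<in>A-{b t}. fact (d a - card {i\<in>insert t S. b i = a}) :: nat) =
        (\<Prod>a\<in>A-{b t}. fact (d a - card {i\<in>S. b i = a}))"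
      by (intro prod.cong refl arg_cong[of _ _ "\<lambda>X. fact (_ - card X)"]) auto
    moreover have "card ?free * fact (d (b t) - card {i\<in>insert t S. b i = b t}) =
        (fact (d (b t) - card {i\<in>S. b i = b t}) :: nat)"
      unfolding * cfree using t fin lt by (simp add: fact_reduce[of "d (b t) - _"])
    ultimately show ?thesis
      using bt assms(2) by (simp add: prod.remove[of A "b t"] mult.assoc[symmetric])
  qed
  finally show ?case .
qed

lemma card_placements:
  assumes "finite I" and "finite A" and "b ` I \<subseteq> A"
    and "\<And>a. a \<in> A \<Longrightarrow> card {i\<in>I. b i = a} = d a"
  shows "card (placements I b d) = (\<Prod>a\<in>A. fact (d a))"
proof -
  have "{\<rho> \<in> placements I b d. restrict \<rho> {} = (\<lambda>_. undefined)} = placements I b d"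
    by (auto simp: restrict_def)
  then show ?thesis
    using card_placement_extensions[OF assms, of "{}" "\<lambda>_. undefined"]
    by (simp add: placements_def[of "{}"])
qed

section \<open>Cancellation of colliding placements\<close>

definition moved :: "('a \<Rightarrow> 'a) \<Rightarrow> 'a set" where
  "moved \<sigma> = {i. \<sigma> i \<noteq> i}"

lemma moved_subset: "\<sigma> permutes I \<Longrightarrow> moved \<sigma> \<subseteq> I"
  by (auto simp: moved_def permutes_def)

lemma moved_image:
  assumes "\<sigma> permutes I" "i \<in> moved \<sigma>"
  shows "\<sigma> i \<in> moved \<sigma>"
  using assms by (auto simp: moved_def dest: injD[OF permutes_inj])

definition compat_perms :: "'i set \<Rightarrow> ('i \<Rightarrow> 'v) \<Rightarrow> ('i \<Rightarrow> 'v) \<Rightarrow> ('i \<Rightarrow> 'i) set" where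
  "compat_perms I b h = {\<sigma>. \<sigma> permutes I \<and> (\<forall>i\<in>I. \<sigma> i = i \<or> h i = b (\<sigma> i))}"

lemma finite_compat_perms: "finite I \<Longrightarrow> finite (compat_perms I b h)"
  unfolding compat_perms_def by (rule finite_subset[OF _ finite_permutations[of I]]) auto

text \<open>
  A single term of the expansion of \<open>\<Prod>\<^sub>c (- Tr hol c)\<close>: each trace is expanded over the values of \<open>g\<close>
  on its cycle.  The signs \<open>- 1\<close> of the cycles of \<open>\<sigma>\<close> are expressed by \<open>sign \<sigma>\<close> and one sign per moved
  index, the form in which they appear in the Leibniz formula.
\<close>
definition perm_weight :: "('i \<Rightarrow> complex mat) \<Rightarrow> ('i \<Rightarrow> nat) \<Rightarrow> ('i \<Rightarrow> 'i) \<Rightarrow> complex" where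
  "perm_weight V g \<sigma> = of_int (sign \<sigma>) * (\<Prod>i\<in>moved \<sigma>. - (V i $$ (g i, g (\<sigma> i))))"

lemma perm_weight_cong:
  assumes "\<sigma> permutes I" and "\<And>i. i \<in> moved \<sigma> \<Longrightarrow> g i = g' i"
  shows "perm_weight V g \<sigma> = perm_weight V g' \<sigma>"
  unfolding perm_weight_def using assms moved_image[OF assms(1)] by simp

text \<open>
  For fixed \<open>S\<close> and \<open>g\<close> the left-hand side is the Leibniz expansion of a determinant with equal columns
  \<open>j\<close> and \<open>k\<close>, so \<open>\<sigma> \<mapsto> transpose j k \<circ> \<sigma>\<close> is a sign-reversing involution.  The absence of loops
  ensures that it creates no fixed points: a moved index \<open>i\<close> is still sent into the block \<open>h i\<close>,
  which is not its own.
\<close>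
lemma sum_perm_weight_collision:
  assumes "finite I" and "S \<subseteq> I" and nl: "\<And>i. i \<in> I \<Longrightarrow> h i \<noteq> b i"
    and jk: "j \<in> S" "k \<in> S" "j \<noteq> k" "b j = b k" "g j = g k"
  shows "(\<Sum>\<sigma> | \<sigma> \<in> compat_perms I b h \<and> moved \<sigma> = S. perm_weight V g \<sigma>) = 0"
proof -
  let ?T = "transpose j k"
  let ?P = "{\<sigma> \<in> compat_perms I b h. moved \<sigma> = S}"
  have fin: "finite ?P"
    using finite_compat_perms[OF assms(1), of b h] by simp
  have jI: "j \<in> I" "k \<in> I" using assms by auto
  have bT: "b (?T y) = b y" for y
    using jk by (auto simp: transpose_def)
  have gT: "g (?T y) = g y" for y
    using jk by (auto simp: transpose_def)
  have maps: "?T \<circ> \<sigma> \<in> ?P" if "\<sigma> \<in> ?P" for \<sigma>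
  proof -
    have s: "\<sigma> permutes I" "moved \<sigma> = S" "\<And>i. i \<in> I \<Longrightarrow> \<sigma> i = i \<or> h i = b (\<sigma> i)"
      using that by (auto simp: compat_perms_def)
    have "?T \<circ> \<sigma> permutes I"
      using s(1) jI by (intro permutes_compose permutes_swap_id)
    have hb: "h i = b (\<sigma> i)" if "i \<in> S" for i
      using s that assms(2) by (auto simp: moved_def)
    have "moved (?T \<circ> \<sigma>) = S"
    proof (intro equalityI subsetI)
      fix i assume "i \<in> moved (?T \<circ> \<sigma>)"
      then show "i \<in> S"
        using jk(1,2) s(2) by (auto simp: moved_def transpose_def split: if_splits)
    next
      fix i assume i: "i \<in> S"
      have "b (?T (\<sigma> i)) \<noteq> b i"
        unfolding bT using hb[OF i] nl i assms(2) by (metis subsetD)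
      then show "i \<in> moved (?T \<circ> \<sigma>)"
        by (auto simp: moved_def)
    qed
    moreover have "\<forall>i\<in>I. (?T \<circ> \<sigma>) i = i \<or> h i = b ((?T \<circ> \<sigma>) i)"
    proof
      fix i assume "i \<in> I"
      show "(?T \<circ> \<sigma>) i = i \<or> h i = b ((?T \<circ> \<sigma>) i)"
      proof (cases "i \<in> S")
        case True
        then show ?thesis using hb bT by simp
      next
        case False
        then have "\<sigma> i = i" "i \<noteq> j" "i \<noteq> k"
          using s(2) jk by (auto simp: moved_def)
        then show ?thesis by simp
      qed
    qed
    ultimately show ?thesis
      using \<open>?T \<circ> \<sigma> permutes I\<close> by (simp add: compat_perms_def)
  qed
  have neg: "perm_weight V g (?T \<circ> \<sigma>) = - perm_weight V g \<sigma>" if "\<sigma> \<in> ?P" for \<sigma>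
  proof -
    have "sign (?T \<circ> \<sigma>) = - sign \<sigma>"
      using that assms(1) jk(3)
      by (subst sign_compose)
        (auto simp: compat_perms_def sign_swap_id permutation_swap_id intro: permutation_permutes[THEN iffD2])
    moreover have "moved (?T \<circ> \<sigma>) = moved \<sigma>"
      using maps[OF that] that by simp
    ultimately show ?thesis
      by (simp add: perm_weight_def gT)
  qed
  have "sum (perm_weight V g) ?P = (\<Sum>\<sigma>\<in>?P. perm_weight V g (?T \<circ> \<sigma>))"
    by (rule sum.reindex_bij_witness[of _ "\<lambda>\<sigma>. ?T \<circ> \<sigma>" "\<lambda>\<sigma>. ?T \<circ> \<sigma>"])
      (use maps in \<open>auto simp: o_assoc\<close>)
  also have "\<dots> = - sum (perm_weight V g) ?P"
    using neg by (simp add: sum_negf)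
  finally show ?thesis
    by simp
qed

text \<open>
  The factorials count the placements with a given restriction to the moved indices, so the weighted
  sum over the injective \<open>g\<close> is a sum over placements; the other \<open>g\<close> cancel, but only when all
  permutations with the same moved set are taken together.
\<close>
lemma sum_weighted_eq_sum_placements:
  assumes "finite I" and "finite A" and "b ` I \<subseteq> A"
    and full: "\<And>a. a \<in> A \<Longrightarrow> card {i\<in>I. b i = a} = d a"
    and nl: "\<And>i. i \<in> I \<Longrightarrow> h i \<noteq> b i"
  shows "(\<Sum>\<sigma>\<in>compat_perms I b h. (\<Prod>a\<in>A. fact (d a - card {i\<in>moved \<sigma>. b i = a})) *
      (\<Sum>g\<in>(\<Pi>\<^sub>E i\<in>moved \<sigma>. {..<d (b i)}). perm_weight V g \<sigma>)) =
    (\<Sum>\<rho>\<in>placements I b d. \<Sum>\<sigma>\<in>compat_perms I b h. perm_weight V \<rho> \<sigma>)"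
proof -
  let ?\<Sigma> = "compat_perms I b h"
  let ?w = "\<lambda>S. (\<Prod>a\<in>A. fact (d a - card {i\<in>S. b i = a})) :: complex"
  let ?F = "\<lambda>S. (\<Pi>\<^sub>E i\<in>S. {..<d (b i)})"
  let ?fibre = "\<lambda>S. {\<sigma>\<in>?\<Sigma>. moved \<sigma> = S}"
  have fin: "finite ?\<Sigma>"
    by (rule finite_compat_perms[OF assms(1)])
  have sub: "moved \<sigma> \<subseteq> I" if "\<sigma> \<in> ?\<Sigma>" for \<sigma>
    using that moved_subset by (auto simp: compat_perms_def)
  have group: "sum f ?\<Sigma> = (\<Sum>S\<in>Pow I. sum f (?fibre S))" for f :: "('a \<Rightarrow> 'a) \<Rightarrow> complex"
    using sub assms(1) by (intro sum.group[symmetric] fin) auto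
  have fibre: "?w S * (\<Sum>g\<in>?F S. \<Sum>\<sigma>\<in>?fibre S. perm_weight V g \<sigma>) =
      (\<Sum>\<rho>\<in>placements I b d. \<Sum>\<sigma>\<in>?fibre S. perm_weight V \<rho> \<sigma>)" if S: "S \<subseteq> I" for S
  proof -
    have finS: "finite S" using S assms(1) finite_subset by blast
    have "(\<Sum>g\<in>?F S. \<Sum>\<sigma>\<in>?fibre S. perm_weight V g \<sigma>) =
        (\<Sum>g\<in>placements S b d. \<Sum>\<sigma>\<in>?fibre S. perm_weight V g \<sigma>)"
    proof (rule sum.mono_neutral_right)
      show "finite (?F S)" using finS by (intro finite_PiE) auto
      show "placements S b d \<subseteq> ?F S" by (auto simp: placements_def)
      show "\<forall>g\<in>?F S - placements S b d. (\<Sum>\<sigma>\<in>?fibre S. perm_weight V g \<sigma>) = 0"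
      proof
        fix g assume "g \<in> ?F S - placements S b d"
        then obtain j k where "j \<in> S" "k \<in> S" "b j = b k" "g j = g k" "j \<noteq> k"
          unfolding placements_def by blast
        then show "(\<Sum>\<sigma>\<in>?fibre S. perm_weight V g \<sigma>) = 0"
          by (intro sum_perm_weight_collision[OF assms(1) S nl])
      qed
    qed
    then have "?w S * (\<Sum>g\<in>?F S. \<Sum>\<sigma>\<in>?fibre S. perm_weight V g \<sigma>) =
        (\<Sum>g\<in>placements S b d. of_nat (card {\<rho> \<in> placements I b d. restrict \<rho> S = g}) *
          (\<Sum>\<sigma>\<in>?fibre S. perm_weight V g \<sigma>))"
      using card_placement_extensions[OF assms(1-4) S]
      by (simp add: sum_distrib_left)
    also have "\<dots> = (\<Sum>g\<in>placements S b d. \<Sum>\<rho> | \<rho> \<in> placements I b d \<and> restrict \<rho> S = g.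
        \<Sum>\<sigma>\<in>?fibre S. perm_weight V (restrict \<rho> S) \<sigma>)"
      by (intro sum.cong) simp_all
    also have "\<dots> = (\<Sum>\<rho>\<in>placements I b d. \<Sum>\<sigma>\<in>?fibre S. perm_weight V (restrict \<rho> S) \<sigma>)"
      using S assms(1) finS
      by (intro sum.group) (auto intro: finite_placements restrict_placements)
    also have "\<dots> = (\<Sum>\<rho>\<in>placements I b d. \<Sum>\<sigma>\<in>?fibre S. perm_weight V \<rho> \<sigma>)"
      by (intro sum.cong refl perm_weight_cong[of _ I]) (auto simp: compat_perms_def)
    finally show ?thesis .
  qed
  have "(\<Sum>\<sigma>\<in>?\<Sigma>. ?w (moved \<sigma>) * (\<Sum>g\<in>?F (moved \<sigma>). perm_weight V g \<sigma>)) =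
      (\<Sum>S\<in>Pow I. \<Sum>\<sigma>\<in>?fibre S. ?w S * (\<Sum>g\<in>?F S. perm_weight V g \<sigma>))"
    unfolding group by (intro sum.cong) auto
  also have "\<dots> = (\<Sum>S\<in>Pow I. ?w S * (\<Sum>g\<in>?F S. \<Sum>\<sigma>\<in>?fibre S. perm_weight V g \<sigma>))"
    unfolding sum_distrib_left[symmetric] by (subst sum.swap) simp
  also have "\<dots> = (\<Sum>S\<in>Pow I. \<Sum>\<rho>\<in>placements I b d. \<Sum>\<sigma>\<in>?fibre S. perm_weight V \<rho> \<sigma>)"
    using fibre by simp
  also have "\<dots> = (\<Sum>\<rho>\<in>placements I b d. \<Sum>\<sigma>\<in>?\<Sigma>. perm_weight V \<rho> \<sigma>)"
    unfolding group by (rule sum.swap)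
  finally show ?thesis .
qed

section \<open>Traces along a cycle as sums over placements\<close>

lemma sum_PiE_insert:
  fixes f :: "('a \<Rightarrow> 'b) \<Rightarrow> 'c::comm_monoid_add"
  assumes "i \<notin> A"
  shows "(\<Sum>g\<in>Pi\<^sub>E (insert i A) F. f g) = (\<Sum>k\<in>F i. \<Sum>g\<in>Pi\<^sub>E A F. f (g(i := k)))"
  unfolding PiE_insert_eq
  by (subst sum.reindex[OF inj_combinator[OF assms]])
    (simp add: sum.cartesian_product case_prod_unfold)

text \<open>
  The contribution of one choice of intermediate indices \<open>g\<close> to the entry of a product of matrices in
  row \<open>g (hd c)\<close> and column \<open>l\<close>.
\<close>
fun path_weight :: "('i \<Rightarrow> complex mat) \<Rightarrow> ('i \<Rightarrow> nat) \<Rightarrow> 'i list \<Rightarrow> nat \<Rightarrow> complex" where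
  "path_weight V g [] l = 1"
| "path_weight V g [i] l = V i $$ (g i, l)"
| "path_weight V g (i # j # c) l = V i $$ (g i, g j) * path_weight V g (j # c) l"

lemma path_weight_cong:
  "(\<And>i. i \<in> set c \<Longrightarrow> g i = g' i) \<Longrightarrow> path_weight V g c l = path_weight V g' c l"
  by (induction V g c l rule: path_weight.induct) auto

lemma path_weight_orbit:
  assumes "distinct c" "successively (\<lambda>i j. \<sigma> i = j) c" "c \<noteq> []"
  shows "path_weight V g c (g (\<sigma> (last c))) = (\<Prod>i\<in>set c. V i $$ (g i, g (\<sigma> i)))"
  using assms by (induction c rule: induct_list012) auto

text \<open>
  The holonomy, for an arbitrary family of matrices and an arbitrary size \<open>D\<close> of the identity matrix
  at the end, so that an induction can shorten the list from the front.
\<close>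
definition path_mat :: "('i \<Rightarrow> complex mat) \<Rightarrow> nat \<Rightarrow> 'i list \<Rightarrow> complex mat" where
  "path_mat V D c = foldr (\<lambda>i A. V i * A) c (1\<^sub>m D)"

text \<open>
  The row index \<open>k\<close> is kept out of the sum over \<open>g\<close>.  Multiplying by a further factor from the left
  sums over it, and this sum supplies the value of \<open>g\<close> at what was the first element of the list.
\<close>
lemma path_mat_index:
  assumes "distinct (i # c)"
    and "successively (\<lambda>i j. dim_col (V i) = d j) (i # c)"
    and "\<And>j. j \<in> set (i # c) \<Longrightarrow> dim_row (V j) = d j"
    and "dim_col (V (last (i # c))) = D"
    and "k < d i" "l < D"
  shows "path_mat V D (i # c) \<in> carrier_mat (d i) D \<and>
    path_mat V D (i # c) $$ (k, l) =
    (\<Sum>g\<in>(\<Pi>\<^sub>E j\<in>set c. {..<d j}). path_weight V (g(i := k)) (i # c) l)"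
  using assms
proof (induction c arbitrary: i k)
  case Nil
  then have "V i \<in> carrier_mat (d i) D" by auto
  then show ?case
    using Nil by (simp add: path_mat_def)
next
  case (Cons j c)
  let ?A = "path_mat V D (j # c)"
  have IH: "?A \<in> carrier_mat (d j) D \<and> ?A $$ (m, l) =
    (\<Sum>g\<in>(\<Pi>\<^sub>E j\<in>set c. {..<d j}). path_weight V (g(j := m)) (j # c) l)" if "m < d j" for m
    by (rule Cons.IH) (use Cons.prems that in auto)
  have V: "V i \<in> carrier_mat (d i) (d j)"
    using Cons.prems by auto
  have dA: "dim_col ?A = D" "dim_row ?A = dim_row (V j)"
    by (induction c arbitrary: j) (auto simp: path_mat_def)
  have eq: "path_mat V D (i # j # c) = V i * ?A"
    by (simp add: path_mat_def)
  have "(V i * ?A) $$ (k, l) = (\<Sum>m<d j. V i $$ (k, m) * ?A $$ (m, l))"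
    using V dA Cons.prems by (simp add: scalar_prod_def lessThan_atLeast0)
  also have "\<dots> = (\<Sum>m<d j. \<Sum>g\<in>(\<Pi>\<^sub>E j\<in>set c. {..<d j}).
      path_weight V ((g(j := m))(i := k)) (i # j # c) l)"
  proof (rule sum.cong[OF refl])
    fix m assume "m \<in> {..<d j}"
    moreover have "path_weight V ((g(j := m))(i := k)) (i # j # c) l =
        V i $$ (k, m) * path_weight V (g(j := m)) (j # c) l" for g
    proof -
      have "path_weight V ((g(j := m))(i := k)) (j # c) l = path_weight V (g(j := m)) (j # c) l"
        by (rule path_weight_cong) (use Cons.prems(1) in auto)
      then show ?thesis
        using Cons.prems(1) by auto
    qed
    ultimately show "V i $$ (k, m) * ?A $$ (m, l) =
        (\<Sum>g\<in>(\<Pi>\<^sub>E j\<in>set c. {..<d j}). path_weight V ((g(j := m))(i := k)) (i # j # c) l)"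
      by (simp only: conjunct2[OF IH] lessThan_iff sum_distrib_left)
  qed
  also have "\<dots> = (\<Sum>g\<in>(\<Pi>\<^sub>E j\<in>set (j # c). {..<d j}). path_weight V (g(i := k)) (i # j # c) l)"
    using Cons.prems(1) by (simp add: sum_PiE_insert)
  finally have "(V i * ?A) $$ (k, l) =
      (\<Sum>g\<in>(\<Pi>\<^sub>E j\<in>set (j # c). {..<d j}). path_weight V (g(i := k)) (i # j # c) l)" .
  moreover have "V i * ?A \<in> carrier_mat (d i) D"
    using V dA by auto
  ultimately show ?case
    unfolding eq by blast
qed

text \<open>
  Taking the trace sums over the row index as well and closes the path: the column index is the
  value of \<open>g\<close> at the first element of the cycle, which follows the last one.
\<close>
lemma trace_path_mat:
  assumes "distinct c" "c \<noteq> []" "successively (\<lambda>i j. \<sigma> i = j) c" "\<sigma> (last c) = hd c"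
    and V: "\<And>i. i \<in> set c \<Longrightarrow> V i \<in> carrier_mat (d i) (d (\<sigma> i))"
  shows "mat_trace (path_mat V (d (hd c)) c) =
    (\<Sum>g\<in>(\<Pi>\<^sub>E i\<in>set c. {..<d i}). \<Prod>i\<in>set c. V i $$ (g i, g (\<sigma> i)))"
proof -
  obtain i c' where c: "c = i # c'" using assms(2) by (cases c) auto
  have "successively (\<lambda>i j. dim_col (V i) = d j) c"
    using assms(3) by (rule successively_mono) (use V in auto)
  moreover have "dim_col (V (last c)) = d (hd c)"
    using V[of "last c"] assms(2,4) by auto
  ultimately have idx: "path_mat V (d i) c \<in> carrier_mat (d i) (d i) \<and>
     path_mat V (d i) c $$ (k, k) =
       (\<Sum>g\<in>(\<Pi>\<^sub>E j\<in>set c'. {..<d j}). path_weight V (g(i := k)) c k)" if "k < d i" for k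
    using path_mat_index[of i c' V d "d i" k k] assms(1) V that unfolding c by auto
  have "dim_row (path_mat V (d i) c) = d i"
    using V[of i] by (auto simp: c path_mat_def)
  then have "mat_trace (path_mat V (d (hd c)) c) = (\<Sum>k<d i. path_mat V (d i) c $$ (k, k))"
    by (simp add: mat_trace_def c)
  also have "\<dots> = (\<Sum>k<d i. \<Sum>g\<in>(\<Pi>\<^sub>E j\<in>set c'. {..<d j}). path_weight V (g(i := k)) c ((g(i := k)) i))"
    using idx by simp
  also have "\<dots> = (\<Sum>g\<in>(\<Pi>\<^sub>E i\<in>set c. {..<d i}). path_weight V g c (g (\<sigma> (last c))))"
    using assms(1,4) unfolding c by (simp add: sum_PiE_insert)
  also have "\<dots> = (\<Sum>g\<in>(\<Pi>\<^sub>E i\<in>set c. {..<d i}). \<Prod>i\<in>set c. V i $$ (g i, g (\<sigma> i)))"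
    by (simp only: path_weight_orbit[OF assms(1,3,2)])
  finally show ?thesis .
qed

section \<open>Products of traces over the cycles of a permutation\<close>

lemma sign_cycle_of_list:
  "c \<noteq> [] \<Longrightarrow> distinct c \<Longrightarrow> sign (cycle_of_list c) = - ((- 1) ^ length c)"
  by (induction c rule: cycle_of_list.induct)
    (auto simp: sign_compose permutation_swap_id permutation_of_cycle sign_swap_id)

lemma sum_PiE_Un:
  fixes f h :: "('a \<Rightarrow> 'b) \<Rightarrow> 'c::comm_semiring_0"
  assumes "A \<inter> B = {}"
    and "\<And>g g'. (\<And>i. i \<in> A \<Longrightarrow> g i = g' i) \<Longrightarrow> f g = f g'"
    and "\<And>g g'. (\<And>i. i \<in> B \<Longrightarrow> g i = g' i) \<Longrightarrow> h g = h g'"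
  shows "(\<Sum>g\<in>Pi\<^sub>E A F. f g) * (\<Sum>g\<in>Pi\<^sub>E B F. h g) = (\<Sum>g\<in>Pi\<^sub>E (A \<union> B) F. f g * h g)"
proof -
  let ?join = "\<lambda>(u, v) i. if i \<in> A then u i else v i"
  have "(\<Sum>g\<in>Pi\<^sub>E A F. f g) * (\<Sum>g\<in>Pi\<^sub>E B F. h g) =
      (\<Sum>(u, v)\<in>Pi\<^sub>E A F \<times> Pi\<^sub>E B F. f u * h v)"
    by (simp add: sum_product sum.cartesian_product)
  also have "\<dots> = (\<Sum>g\<in>Pi\<^sub>E (A \<union> B) F. f g * h g)"
  proof (rule sum.reindex_bij_witness[of _ "\<lambda>g. (restrict g A, restrict g B)" ?join])
    fix uv assume "uv \<in> Pi\<^sub>E A F \<times> Pi\<^sub>E B F"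
    then obtain u v where uv: "uv = (u, v)" "u \<in> Pi\<^sub>E A F" "v \<in> Pi\<^sub>E B F" by blast
    show "(restrict (?join uv) A, restrict (?join uv) B) = uv"
      using uv assms(1) by (auto simp: fun_eq_iff restrict_def PiE_iff extensional_def)
    show "?join uv \<in> Pi\<^sub>E (A \<union> B) F"
      using uv by (auto simp: PiE_iff extensional_def)
    have "f (?join uv) = f u"
      unfolding uv by (rule assms(2)) simp
    moreover have "h (?join uv) = h v"
      unfolding uv by (rule assms(3)) (use assms(1) in auto)
    ultimately show "f (?join uv) * h (?join uv) = (case uv of (u, v) \<Rightarrow> f u * h v)"
      using uv by simp
  next
    fix g assume g: "g \<in> Pi\<^sub>E (A \<union> B) F"
    show "?join (restrict g A, restrict g B) = g"
      using g by (auto simp: fun_eq_iff PiE_iff extensional_def)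
    show "(restrict g A, restrict g B) \<in> Pi\<^sub>E A F \<times> Pi\<^sub>E B F"
      using g by auto
  qed
  finally show ?thesis .
qed

lemma set_support_eq:
  assumes "permutation \<sigma>" "set (support \<sigma> i) \<inter> set (support \<sigma> j) \<noteq> {}"
  shows "set (support \<sigma> i) = set (support \<sigma> j)"
  using disjointD[OF disjoint_support[OF assms(1)] rangeI rangeI, of i j] assms(2) by metis


lemma nontrivial_cycleE:
  assumes "permutation \<sigma>" "c \<in> nontrivial_cycles \<sigma>"
  obtains i where "c = support \<sigma> i" "\<sigma> i \<noteq> i" "\<And>j. j \<in> set c \<Longrightarrow> i \<le> j" "i \<in> set c" "hd c = i"
    "distinct c" "c \<noteq> []" "successively (\<lambda>i j. \<sigma> i = j) c" "\<sigma> (last c) = hd c"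
proof -
  obtain i where i: "c = support \<sigma> i" "\<sigma> i \<noteq> i" "\<And>j. j \<in> set c \<Longrightarrow> i \<le> j"
    using assms(2) by (auto simp: nontrivial_cycles_def)
  note lp = least_power_of_permutation[OF assms(1), of i]
  have hd: "hd c = i"
    using lp by (simp add: i(1) hd_map)
  have "c \<noteq> []"
    using lp by (simp add: i(1))
  moreover from this have "i \<in> set c"
    using hd hd_in_set by blast
  moreover have "distinct c"
    unfolding i(1) by (rule cycle_of_permutation[OF assms(1)])
  moreover have "successively (\<lambda>i j. \<sigma> i = j) c"
    by (auto simp: i(1) successively_conv_nth)
  moreover have "\<sigma> (last c) = hd c"
  proof -
    obtain m where m: "least_power \<sigma> i = Suc m"
      using lp(2) gr0_implies_Suc by blast
    then have "last c = (\<sigma> ^^ m) i"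
      by (simp add: i(1))
    then show ?thesis
      using lp(1) m hd by simp
  qed
  ultimately show ?thesis
    using that i hd by blast
qed

lemma disjoint_nontrivial_cycles:
  assumes "permutation \<sigma>" "c \<in> nontrivial_cycles \<sigma>" "c' \<in> nontrivial_cycles \<sigma>" "c \<noteq> c'"
  shows "set c \<inter> set c' = {}"
proof (rule ccontr)
  assume ne: "set c \<inter> set c' \<noteq> {}"
  obtain i where i: "c = support \<sigma> i" "\<And>j. j \<in> set c \<Longrightarrow> i \<le> j" "i \<in> set c"
    by (rule nontrivial_cycleE[OF assms(1,2)]) blast
  obtain i' where i': "c' = support \<sigma> i'" "\<And>j. j \<in> set c' \<Longrightarrow> i' \<le> j" "i' \<in> set c'"
    by (rule nontrivial_cycleE[OF assms(1,3)]) blast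
  have "set c = set c'"
    using ne unfolding i(1) i'(1) by (rule set_support_eq[OF assms(1)])
  then have "i = i'"
    using i i' by (metis order_antisym)
  then show False
    using i i' assms(4) by simp
qed

lemma Union_nontrivial_cycles:
  assumes "permutation \<sigma>"
  shows "(\<Union>c\<in>nontrivial_cycles \<sigma>. set c) = moved \<sigma>"
proof (intro equalityI subsetI)
  fix j assume "j \<in> (\<Union>c\<in>nontrivial_cycles \<sigma>. set c)"
  then obtain i where "\<sigma> i \<noteq> i" "j \<in> set (support \<sigma> i)"
    by (auto simp: nontrivial_cycles_def)
  then show "j \<in> moved \<sigma>"
    using support_coverture[OF assms] by (auto simp: moved_def)
next
  fix j assume "j \<in> moved \<sigma>"
  define i where "i = Min (set (support \<sigma> j))"
  have j: "j \<in> set (support \<sigma> j)"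
    unfolding support_set[OF assms] by (auto intro: range_eqI[of _ _ 0])
  then have i: "i \<in> set (support \<sigma> j)"
    unfolding i_def by (intro Min_in) auto
  have "i \<in> set (support \<sigma> i)"
    unfolding support_set[OF assms] by (auto intro: range_eqI[of _ _ 0])
  then have eq: "set (support \<sigma> i) = set (support \<sigma> j)"
    using i by (intro set_support_eq[OF assms]) (metis IntI empty_iff)
  have "i \<in> moved \<sigma>"
    using i \<open>j \<in> moved \<sigma>\<close> support_coverture[OF assms] unfolding moved_def by blast
  then have "support \<sigma> i \<in> nontrivial_cycles \<sigma>"
    unfolding nontrivial_cycles_def moved_def eq using eq i_def
    by (auto intro!: exI[of _ i] simp del: set_map)
  then show "j \<in> (\<Union>c\<in>nontrivial_cycles \<sigma>. set c)"
    using j eq by blast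
qed

text \<open>
  The cycles have disjoint supports, so the product of the sums over \<open>g\<close> on each support is one sum
  over \<open>g\<close> on their union.  A cycle of length \<open>r\<close> has sign \<open>- (- 1)\<^sup>r\<close>, and together with a sign for
  each of its \<open>r\<close> factors this yields the sign \<open>- 1\<close> in front of its trace.
\<close>
lemma prod_cycle_traces:
  fixes \<sigma> :: "nat \<Rightarrow> nat"
  assumes perm: "permutation \<sigma>"
    and V: "\<And>i. i \<in> moved \<sigma> \<Longrightarrow> V i \<in> carrier_mat (d i) (d (\<sigma> i))"
  shows "(\<Prod>c\<in>nontrivial_cycles \<sigma>. - mat_trace (path_mat V (d (hd c)) c)) =
    (\<Sum>g\<in>(\<Pi>\<^sub>E i\<in>moved \<sigma>. {..<d i}). perm_weight V g \<sigma>)"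
proof -
  let ?C = "nontrivial_cycles \<sigma>"
  let ?U = "\<lambda>D. \<Union>c\<in>D. set c"
  let ?on = "\<lambda>D i. if i \<in> ?U D then \<sigma> i else i"
  let ?w = "\<lambda>g i. - (V i $$ (g i, g (\<sigma> i)))"
  have "finite (moved \<sigma>)"
    using perm unfolding moved_def permutation by simp
  moreover have "?C \<subseteq> support \<sigma> ` moved \<sigma>"
    by (auto simp: nontrivial_cycles_def moved_def)
  ultimately have "finite ?C"
    by (rule finite_surj)
  have closed: "\<sigma> i \<in> set c" if c: "c \<in> ?C" and i: "i \<in> set c" for c i
  proof -
    obtain j where j: "c = support \<sigma> j"
      by (rule nontrivial_cycleE[OF perm c])
    then obtain m where "i = (\<sigma> ^^ m) j"
      using i by auto
    then have "\<sigma> i = (\<sigma> ^^ Suc m) j" by simp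
    then show ?thesis
      unfolding j support_set[OF perm] by blast
  qed
  have "permutation (?on D) \<and> (\<Prod>c\<in>D. - mat_trace (path_mat V (d (hd c)) c)) =
      of_int (sign (?on D)) * (\<Sum>g\<in>(\<Pi>\<^sub>E i\<in>?U D. {..<d i}). \<Prod>i\<in>?U D. ?w g i)"
    if "finite D" "D \<subseteq> ?C" for D
    using that
  proof (induction D)
    case empty
    show ?case by (simp add: permutation_id[unfolded id_def])
  next
    case (insert c D)
    then have c: "c \<in> ?C" by simp
    obtain i where i: "c = support \<sigma> i" "distinct c" "c \<noteq> []" "successively (\<lambda>i j. \<sigma> i = j) c" "\<sigma> (last c) = hd c"
      by (rule nontrivial_cycleE[OF perm c]) blast
    have disj: "set c \<inter> ?U D = {}"
      using insert disjoint_nontrivial_cycles[OF perm c] by blast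
    \<comment> \<open>The partial permutation \<open>?on D\<close> acts as \<open>\<sigma>\<close> on the cycles in \<open>D\<close> only, so that its sign collects
      the signs of exactly these cycles.\<close>
    have on: "?on (insert c D) = cycle_of_list c \<circ> ?on D"
    proof
      fix j show "?on (insert c D) j = (cycle_of_list c \<circ> ?on D) j"
      proof (cases "j \<in> set c")
        case True
        then show ?thesis
          using disj cycle_restrict[OF perm, of j i] i(1) by (auto simp del: set_map)
      next
        case False
        have "\<sigma> j \<notin> set c" if "j \<in> ?U D"
          using that disj closed insert.prems by blast
        then show ?thesis
          using False by (auto simp: id_outside_supp)
      qed
    qed
    have sgn: "sign (?on (insert c D)) = - ((- 1) ^ length c) * sign (?on D)"
      using insert sign_cycle_of_list[OF i(3,2)] unfolding on
      by (simp add: sign_compose permutation_of_cycle)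
    have tr: "- mat_trace (path_mat V (d (hd c)) c) =
        - ((- 1) ^ length c) * (\<Sum>g\<in>(\<Pi>\<^sub>E i\<in>set c. {..<d i}). \<Prod>i\<in>set c. ?w g i)"
    proof -
      have "mat_trace (path_mat V (d (hd c)) c) =
          (\<Sum>g\<in>(\<Pi>\<^sub>E i\<in>set c. {..<d i}). \<Prod>i\<in>set c. V i $$ (g i, g (\<sigma> i)))"
        using c Union_nontrivial_cycles[OF perm] V by (intro trace_path_mat i) auto
      moreover have "(\<Prod>i\<in>set c. ?w g i) = (- 1) ^ length c * (\<Prod>i\<in>set c. V i $$ (g i, g (\<sigma> i)))" for g
        using i(2) by (simp add: prod_uminus distinct_card)
      ultimately show ?thesis
        by (simp add: sum_distrib_left[symmetric] flip: power_mult_distrib mult.assoc)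
    qed
    have split: "(\<Sum>g\<in>(\<Pi>\<^sub>E i\<in>?U (insert c D). {..<d i}). \<Prod>i\<in>?U (insert c D). ?w g i) =
        (\<Sum>g\<in>(\<Pi>\<^sub>E i\<in>set c. {..<d i}). \<Prod>i\<in>set c. ?w g i) *
        (\<Sum>g\<in>(\<Pi>\<^sub>E i\<in>?U D. {..<d i}). \<Prod>i\<in>?U D. ?w g i)"
    proof -
      have cD: "\<sigma> i \<in> ?U D" if "i \<in> ?U D" for i
        using that closed insert.prems by blast
      have "(\<Prod>i\<in>?U (insert c D). ?w g i) = (\<Prod>i\<in>set c. ?w g i) * (\<Prod>i\<in>?U D. ?w g i)" for g
        using disj insert.hyps(1) by (simp add: prod.union_disjoint)
      then show ?thesis
        using closed[OF c] cD by (subst sum_PiE_Un[OF disj]) (auto intro!: prod.cong)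
    qed
    have "permutation (?on (insert c D))"
      unfolding on using insert by (intro permutation_compose permutation_of_cycle) auto
    moreover have "(\<Prod>c\<in>insert c D. - mat_trace (path_mat V (d (hd c)) c)) =
      of_int (sign (?on (insert c D))) *
      (\<Sum>g\<in>(\<Pi>\<^sub>E i\<in>?U (insert c D). {..<d i}). \<Prod>i\<in>?U (insert c D). ?w g i)"
      unfolding split sgn prod.insert[OF insert.hyps(1,2)] tr using insert.IH insert.prems by simp
    ultimately show ?case by blast
  qed
  note this[OF \<open>finite ?C\<close> order.refl]
  moreover have "?on ?C = \<sigma>"
    unfolding Union_nontrivial_cycles[OF perm] by (auto simp: moved_def)
  ultimately show ?thesis
    unfolding Union_nontrivial_cycles[OF perm] by (simp add: perm_weight_def sum_distrib_left)
qed

section \<open>The determinant in the basis given by a placement\<close>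

text \<open>
  Renaming rows and columns by the same bijection does not change the Leibniz sum, since conjugation
  preserves the sign of a permutation.
\<close>
lemma det_mat_reindex:
  assumes "finite I" and \<phi>: "bij_betw \<phi> I {0..<N}"
  shows "det (mat N N f) = (\<Sum>\<sigma> | \<sigma> permutes I. signof \<sigma> * (\<Prod>i\<in>I. f (\<phi> i, \<phi> (\<sigma> i))))"
proof -
  let ?m = "map_permutation I \<phi>"
  have inj: "inj_on \<phi> I" using \<phi> by (simp add: bij_betw_def)
  have "det (mat N N f) = (\<Sum>\<pi> | \<pi> permutes {0..<N}. signof \<pi> * (\<Prod>k\<in>{0..<N}. f (k, \<pi> k)))"
    unfolding det_def'[OF mat_carrier]
    by (intro sum.cong refl arg_cong2[of _ _ _ _ "(*)"] prod.cong)
      (auto dest: permutes_in_image)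
  also have "\<dots> = (\<Sum>\<sigma> | \<sigma> permutes I. signof (?m \<sigma>) * (\<Prod>k\<in>{0..<N}. f (k, ?m \<sigma> k)))"
  proof (rule sum.reindex_bij_witness[of _ ?m "map_permutation {0..<N} (inv_into I \<phi>)"])
    fix \<pi> assume p: "\<pi> \<in> {\<pi>. \<pi> permutes {0..<N}}"
    show "?m (map_permutation {0..<N} (inv_into I \<phi>) \<pi>) = \<pi>"
      by (rule map_permutation_compose_inv[OF bij_betw_inv_into[OF \<phi>]])
        (use p \<phi> in \<open>auto simp: bij_betw_def f_inv_into_f\<close>)
    show "map_permutation {0..<N} (inv_into I \<phi>) \<pi> \<in> {\<sigma>. \<sigma> permutes I}"
      using p map_permutation_permutes[OF bij_betw_inv_into[OF \<phi>]] by simp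
    show "signof (?m (map_permutation {0..<N} (inv_into I \<phi>) \<pi>)) *
        (\<Prod>k\<in>{0..<N}. f (k, ?m (map_permutation {0..<N} (inv_into I \<phi>) \<pi>) k)) =
        signof \<pi> * (\<Prod>k\<in>{0..<N}. f (k, \<pi> k))"
      using \<open>?m (map_permutation {0..<N} (inv_into I \<phi>) \<pi>) = \<pi>\<close> by simp
  next
    fix \<sigma> assume p: "\<sigma> \<in> {\<sigma>. \<sigma> permutes I}"
    show "map_permutation {0..<N} (inv_into I \<phi>) (?m \<sigma>) = \<sigma>"
      by (rule map_permutation_compose_inv[OF \<phi>]) (use p inj in auto)
    show "?m \<sigma> \<in> {\<pi>. \<pi> permutes {0..<N}}"
      using p map_permutation_permutes[OF \<phi>] by simp
  qed
  also have "\<dots> = (\<Sum>\<sigma> | \<sigma> permutes I. signof \<sigma> * (\<Prod>i\<in>I. f (\<phi> i, \<phi> (\<sigma> i))))"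
  proof (intro sum.cong refl arg_cong2[of _ _ _ _ "(*)"])
    fix \<sigma> assume "\<sigma> \<in> {\<sigma>. \<sigma> permutes I}"
    then show "signof (?m \<sigma>) = signof \<sigma>"
      using sign_map_permutation[OF inj _ assms(1)] by simp
    show "(\<Prod>k\<in>{0..<N}. f (k, ?m \<sigma> k)) = (\<Prod>i\<in>I. f (\<phi> i, \<phi> (\<sigma> i)))"
      using map_permutation_apply[OF inj]
      by (simp add: prod.reindex_bij_betw[OF \<phi>, symmetric])
  qed
  finally show ?thesis .
qed

text \<open>
  The right-hand side is the Leibniz formula for the identity minus the matrix whose row \<open>i\<close> is
  supported on the columns of the block \<open>h i\<close>.  A permutation that is not compatible has a zero
  factor; for a compatible one the diagonal factors are 1, because \<open>h i \<noteq> b i\<close> makes the subtracted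
  entry vanish there.
\<close>
lemma sum_compat_perm_weight:
  assumes "finite I" and nl: "\<And>i. i \<in> I \<Longrightarrow> h i \<noteq> b i"
  shows "(\<Sum>\<sigma>\<in>compat_perms I b h. perm_weight V \<rho> \<sigma>) =
    (\<Sum>\<sigma> | \<sigma> permutes I. signof \<sigma> *
      (\<Prod>i\<in>I. (if \<sigma> i = i then 1 else 0) - (if h i = b (\<sigma> i) then V i $$ (\<rho> i, \<rho> (\<sigma> i)) else 0)))"
    (is "_ = (\<Sum>\<sigma> | _ \<sigma>. signof \<sigma> * (\<Prod>i\<in>I. ?B \<sigma> i))")
proof -
  have eq: "perm_weight V \<rho> \<sigma> = signof \<sigma> * (\<Prod>i\<in>I. ?B \<sigma> i)" if "\<sigma> \<in> compat_perms I b h" for \<sigma>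
  proof -
    have s: "\<sigma> permutes I" "\<And>i. i \<in> I \<Longrightarrow> \<sigma> i = i \<or> h i = b (\<sigma> i)"
      using that by (auto simp: compat_perms_def)
    have "(\<Prod>i\<in>I. ?B \<sigma> i) = (\<Prod>i\<in>moved \<sigma>. ?B \<sigma> i)"
      using assms moved_subset[OF s(1)] by (intro prod.mono_neutral_right) (auto simp: moved_def)
    also have "\<dots> = (\<Prod>i\<in>moved \<sigma>. - (V i $$ (\<rho> i, \<rho> (\<sigma> i))))"
      using s(2) moved_subset[OF s(1)] by (intro prod.cong) (auto simp: moved_def)
    finally show ?thesis
      by (simp add: perm_weight_def)
  qed
  have "(\<Sum>\<sigma> | \<sigma> permutes I. signof \<sigma> * (\<Prod>i\<in>I. ?B \<sigma> i)) =
      (\<Sum>\<sigma>\<in>compat_perms I b h. signof \<sigma> * (\<Prod>i\<in>I. ?B \<sigma> i))"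
  proof (rule sum.mono_neutral_right)
    show "\<forall>\<sigma>\<in>{\<sigma>. \<sigma> permutes I} - compat_perms I b h. signof \<sigma> * (\<Prod>i\<in>I. ?B \<sigma> i) = 0"
    proof
      fix \<sigma> assume "\<sigma> \<in> {\<sigma>. \<sigma> permutes I} - compat_perms I b h"
      then obtain i where "i \<in> I" "\<sigma> i \<noteq> i" "h i \<noteq> b (\<sigma> i)"
        by (auto simp: compat_perms_def)
      then have "(\<Prod>i\<in>I. ?B \<sigma> i) = 0"
        using assms(1) by (intro prod_zero bexI[of _ i]) auto
      then show "signof \<sigma> * (\<Prod>i\<in>I. ?B \<sigma> i) = 0" by simp
    qed
  qed (use finite_permutations[OF assms(1)] in \<open>auto simp: compat_perms_def\<close>)
  with eq show ?thesis by simp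
qed

text \<open>
  The determinant is linear in each row; here row \<open>i\<close> is a linear combination of the rows \<open>F e i\<close> with
  \<open>e \<in> E i\<close>.
\<close>
lemma leibniz_row_expansion:
  fixes x :: "'e \<Rightarrow> 'a::comm_ring_1"
  assumes "finite I" "\<And>i. i \<in> I \<Longrightarrow> finite (E i)"
  shows "(\<Sum>\<xi>\<in>Pi\<^sub>E I E. (\<Prod>i\<in>I. x (\<xi> i)) *
      (\<Sum>\<sigma> | \<sigma> permutes I. signof \<sigma> * (\<Prod>i\<in>I. F (\<xi> i) i (\<sigma> i)))) =
    (\<Sum>\<sigma> | \<sigma> permutes I. signof \<sigma> * (\<Prod>i\<in>I. \<Sum>e\<in>E i. x e * F e i (\<sigma> i)))"
proof -
  have "(\<Sum>\<xi>\<in>Pi\<^sub>E I E. (\<Prod>i\<in>I. x (\<xi> i)) *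
      (\<Sum>\<sigma> | \<sigma> permutes I. signof \<sigma> * (\<Prod>i\<in>I. F (\<xi> i) i (\<sigma> i)))) =
    (\<Sum>\<xi>\<in>Pi\<^sub>E I E. \<Sum>\<sigma> | \<sigma> permutes I. signof \<sigma> * (\<Prod>i\<in>I. x (\<xi> i) * F (\<xi> i) i (\<sigma> i)))"
    by (simp add: sum_distrib_left prod.distrib mult_ac)
  also have "\<dots> = (\<Sum>\<sigma> | \<sigma> permutes I. signof \<sigma> * (\<Sum>\<xi>\<in>Pi\<^sub>E I E. \<Prod>i\<in>I. x (\<xi> i) * F (\<xi> i) i (\<sigma> i)))"
    by (subst sum.swap) (simp add: sum_distrib_left)
  finally show ?thesis
    using assms by (simp add: prod_sum_PiE)
qed

abbreviation offset :: "(nat \<Rightarrow> nat) \<Rightarrow> nat \<Rightarrow> nat" where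
  "offset n a \<equiv> (\<Sum>v=1..<a. n v)"

lemma offset_mono: "1 \<le> a \<Longrightarrow> a < a' \<Longrightarrow> offset n a + n a \<le> offset n a'"
proof -
  assume a: "1 \<le> a" "a < a'"
  have "offset n a + n a = offset n (Suc a)"
    using a by simp
  also have "\<dots> \<le> offset n a'"
    using a by (intro sum_mono2) auto
  finally show ?thesis .
qed

lemma block_unique:
  assumes "1 \<le> a" "i \<in> interval n a"
  shows "block n i = a"
  unfolding block_def
proof (rule the_equality)
  fix a' assume a': "1 \<le> a' \<and> i \<in> interval n a'"
  show "a' = a"
    using a' assms offset_mono[of a a' n] offset_mono[of a' a n]
    by (cases a a' rule: linorder_cases) (auto simp: interval_def)
qed (use assms in auto)

lemma block_index:
  assumes "1 \<le> a" "k < n a"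
  shows "block n (offset n a + k + 1) = a" "position n (offset n a + k + 1) = k"
proof -
  show "block n (offset n a + k + 1) = a"
    using assms by (intro block_unique) (auto simp: interval_def)
  then show "position n (offset n a + k + 1) = k"
    by (simp add: position_def)
qed

lemma offset_total_dim: "a \<le> p \<Longrightarrow> 1 \<le> a \<Longrightarrow> offset n a + n a \<le> total_dim p n"
  using offset_mono[of a "Suc p" n] by (simp add: total_dim_def atLeastLessThanSuc_atLeastAtMost)

lemma block_mem:
  assumes "i \<in> {1..total_dim p n}"
  shows "block n i \<in> {1..p} \<and> i \<in> interval n (block n i)"
proof -
  have "\<exists>a\<in>{1..p}. i \<in> interval n a"
    using assms
  proof (induction p)
    case 0
    then show ?case by (simp add: total_dim_def)
  next
    case (Suc p)
    show ?case
    proof (cases "i \<le> total_dim p n")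
      case True
      then obtain a where "a \<in> {1..p}" "i \<in> interval n a"
        using Suc by auto
      then show ?thesis by (intro bexI[of _ a]) auto
    next
      case False
      then have "i \<in> interval n (Suc p)"
        using Suc.prems by (auto simp: interval_def total_dim_def atLeastLessThanSuc_atLeastAtMost)
      then show ?thesis by auto
    qed
  qed
  then show ?thesis
    using block_unique by (metis atLeastAtMost_iff)
qed

lemma block_fibre:
  assumes "a \<in> {1..p}"
  shows "{i\<in>{1..total_dim p n}. block n i = a} = interval n a"
proof (intro equalityI subsetI)
  fix i assume "i \<in> interval n a"
  then show "i \<in> {i\<in>{1..total_dim p n}. block n i = a}"
    using assms block_unique[of a i n] offset_total_dim[of a p n] by (auto simp: interval_def)
qed (use block_mem in blast)

lemma twisted_laplacian_entry:
  assumes "fin_digraph G"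
    and U: "\<And>e. e \<in> arcs G \<Longrightarrow> U e \<in> carrier_mat (n (tail G e)) (n (head G e))"
    and "k < n v" "position n j < n (block n j)"
  shows "twisted_laplacian G n x U (basis_section n j) v $ k =
    (\<Sum>e\<in>out_arcs G v. x e *
      ((if v = block n j \<and> k = position n j then 1 else 0) -
       (if head G e = block n j then U e $$ (k, position n j) else 0)))"
proof -
  interpret fin_digraph G by fact
  let ?f = "basis_section n j"
  have f: "?f w \<in> carrier_vec (n w)" for w
    by (simp add: basis_section_def)
  have summand: "x e \<cdot>\<^sub>v (?f (tail G e) - U e *\<^sub>v ?f (head G e)) \<in> carrier_vec (n v)"
    if "e \<in> out_arcs G v" for e
    using U[of e] f that by auto
  have "twisted_laplacian G n x U ?f v $ k =
      (\<Sum>e\<in>out_arcs G v. (x e \<cdot>\<^sub>v (?f (tail G e) - U e *\<^sub>v ?f (head G e))) $ k)"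
    unfolding twisted_laplacian_def
    by (rule index_finsum_vec) (use finite_out_arcs assms(3) summand in auto)
  also have "\<dots> = (\<Sum>e\<in>out_arcs G v. x e *
      ((if v = block n j \<and> k = position n j then 1 else 0) -
       (if head G e = block n j then U e $$ (k, position n j) else 0)))"
  proof (rule sum.cong[OF refl])
    fix e assume e: "e \<in> out_arcs G v"
    then have Ue: "U e \<in> carrier_mat (n v) (n (head G e))"
      using U[of e] by simp
    have "(U e *\<^sub>v ?f (head G e)) $ k = (if head G e = block n j then U e $$ (k, position n j) else 0)"
      using Ue assms(3,4) by (auto simp: basis_section_def scalar_prod_right_unit)
    moreover have "?f v $ k = (if v = block n j \<and> k = position n j then 1 else 0)"
      using assms(3,4) by (auto simp: basis_section_def)
    ultimately show "(x e \<cdot>\<^sub>v (?f (tail G e) - U e *\<^sub>v ?f (head G e))) $ k =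
      x e * ((if v = block n j \<and> k = position n j then 1 else 0) -
       (if head G e = block n j then U e $$ (k, position n j) else 0))"
      using e Ue f assms(3) by simp
  qed
  finally show ?thesis .
qed

text \<open>
  A placement permutes the canonical basis within the blocks; indices are shifted to start at 0, as
  in matrices.
\<close>
lemma bij_betw_placement:
  assumes "\<rho> \<in> placements {1..total_dim p n} (block n) n"
  shows "bij_betw (\<lambda>i. offset n (block n i) + \<rho> i) {1..total_dim p n} {0..<total_dim p n}"
proof -
  let ?I = "{1..total_dim p n}" and ?\<phi> = "\<lambda>i. offset n (block n i) + \<rho> i"
  have r: "\<rho> i < n (block n i)" if "i \<in> ?I" for i
    using assms PiE_mem[OF _ that] unfolding placements_def by blast
  have b: "1 \<le> block n i" "block n i \<le> p" if "i \<in> ?I" for i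
    using block_mem[OF that] by auto
  have inj: "inj_on ?\<phi> ?I"
  proof (rule inj_onI)
    fix i j assume ij: "i \<in> ?I" "j \<in> ?I" "?\<phi> i = ?\<phi> j"
    have "block n i = block n j" "\<rho> i = \<rho> j"
      using block_index[of "block n i" "\<rho> i" n, OF b(1)[OF ij(1)] r[OF ij(1)]]
        block_index[of "block n j" "\<rho> j" n, OF b(1)[OF ij(2)] r[OF ij(2)]] ij(3)
      by metis+
    then show "i = j"
      using ij assms unfolding placements_def by blast
  qed
  have "?\<phi> ` ?I \<subseteq> {0..<total_dim p n}"
  proof
    fix k assume "k \<in> ?\<phi> ` ?I"
    then obtain i where i: "i \<in> ?I" "k = ?\<phi> i" by blast
    show "k \<in> {0..<total_dim p n}"
      using r[OF i(1)] offset_total_dim[OF b(2)[OF i(1)] b(1)[OF i(1)], of n] i(2) by simp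
  qed
  then have "?\<phi> ` ?I = {0..<total_dim p n}"
    using card_image[OF inj] by (intro card_subset_eq) auto
  with inj show ?thesis
    by (simp add: bij_betw_def)
qed

text \<open>
  The placement \<open>i \<mapsto> position n i\<close> gives the row expansion of the matrix of \<open>\<Delta>\<close> itself.  Any other
  \<open>\<rho>\<close> stays within the blocks and therefore permutes rows that are expanded over the same set of arcs,
  so the same set of maps \<open>\<xi>\<close> occurs.
\<close>
lemma det_endo_laplacian_placement:
  fixes x :: "'e \<Rightarrow> complex"
  assumes "fin_digraph G"
    and U: "\<And>e. e \<in> arcs G \<Longrightarrow> U e \<in> carrier_mat (n (tail G e)) (n (head G e))"
    and nl: "\<And>e. e \<in> arcs G \<Longrightarrow> tail G e \<noteq> head G e"
    and \<rho>: "\<rho> \<in> placements {1..total_dim p n} (block n) n"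
  shows "det_endo p n (twisted_laplacian G n x U) =
    (\<Sum>\<xi>\<in>arc_choices G p n. (\<Prod>i=1..total_dim p n. x (\<xi> i)) *
      (\<Sum>\<sigma>\<in>compatible_perms G p n \<xi>. perm_weight (\<lambda>i. U (\<xi> i)) \<rho> \<sigma>))"
proof -
  interpret fin_digraph G by fact
  let ?I = "{1..total_dim p n}" and ?\<phi> = "\<lambda>i. offset n (block n i) + \<rho> i"
  define F where "F e i j = (if j = i then 1 else 0) -
      (if head G e = block n j then U e $$ (\<rho> i, \<rho> j) else 0)" for e i j
  define L where "L i j = twisted_laplacian G n x U (basis_section n (j + 1))
      (block n (i + 1)) $ position n (i + 1)" for i j
  have r: "\<rho> i < n (block n i)" if "i \<in> ?I" for i
    using \<rho> PiE_mem[OF _ that] unfolding placements_def by blast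
  have at: "block n (?\<phi> i + 1) = block n i" "position n (?\<phi> i + 1) = \<rho> i" if "i \<in> ?I" for i
    using block_index[of "block n i" "\<rho> i" n] block_mem[OF that] r[OF that] by auto
  have inj: "j = i" if "i \<in> ?I" "j \<in> ?I" "block n i = block n j" "\<rho> i = \<rho> j" for i j
    using \<rho> that unfolding placements_def by blast
  have entry: "L (?\<phi> i) (?\<phi> j) = (\<Sum>e\<in>out_arcs G (block n i). x e * F e i j)"
    if "i \<in> ?I" "j \<in> ?I" for i j
  proof -
    have "L (?\<phi> i) (?\<phi> j) = (\<Sum>e\<in>out_arcs G (block n i). x e *
      ((if block n i = block n j \<and> \<rho> i = \<rho> j then 1 else 0) -
       (if head G e = block n j then U e $$ (\<rho> i, \<rho> j) else 0)))"
      unfolding L_def at[OF that(1)]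
      using twisted_laplacian_entry[OF assms(1) U, of "\<rho> i" "block n i" "?\<phi> j + 1" x,
        unfolded at[OF that(2)]] r that by blast
    also have "\<dots> = (\<Sum>e\<in>out_arcs G (block n i). x e * F e i j)"
      unfolding F_def using inj[OF that] by (intro sum.cong) auto
    finally show ?thesis .
  qed
  have "(\<Sum>\<xi>\<in>arc_choices G p n. (\<Prod>i\<in>?I. x (\<xi> i)) *
      (\<Sum>\<sigma>\<in>compatible_perms G p n \<xi>. perm_weight (\<lambda>i. U (\<xi> i)) \<rho> \<sigma>)) =
    (\<Sum>\<xi>\<in>(\<Pi>\<^sub>E i\<in>?I. out_arcs G (block n i)). (\<Prod>i\<in>?I. x (\<xi> i)) *
      (\<Sum>\<sigma> | \<sigma> permutes ?I. signof \<sigma> * (\<Prod>i\<in>?I. F (\<xi> i) i (\<sigma> i))))"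
    unfolding arc_choices_def
  proof (rule sum.cong[OF refl])
    fix \<xi> assume \<xi>: "\<xi> \<in> (\<Pi>\<^sub>E i\<in>?I. out_arcs G (block n i))"
    have "head G (\<xi> i) \<noteq> block n i" if "i \<in> ?I" for i
      using PiE_mem[OF \<xi> that] nl[of "\<xi> i"] by auto
    then have "(\<Sum>\<sigma>\<in>compat_perms ?I (block n) (\<lambda>i. head G (\<xi> i)). perm_weight (\<lambda>i. U (\<xi> i)) \<rho> \<sigma>) =
        (\<Sum>\<sigma> | \<sigma> permutes ?I. signof \<sigma> * (\<Prod>i\<in>?I. F (\<xi> i) i (\<sigma> i)))"
      unfolding F_def by (intro sum_compat_perm_weight) auto
    then show "(\<Prod>i\<in>?I. x (\<xi> i)) *
      (\<Sum>\<sigma>\<in>compatible_perms G p n \<xi>. perm_weight (\<lambda>i. U (\<xi> i)) \<rho> \<sigma>) =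
      (\<Prod>i\<in>?I. x (\<xi> i)) *
      (\<Sum>\<sigma> | \<sigma> permutes ?I. signof \<sigma> * (\<Prod>i\<in>?I. F (\<xi> i) i (\<sigma> i)))"
      by (simp add: compatible_perms_def compat_perms_def)
  qed
  also have "\<dots> = (\<Sum>\<sigma> | \<sigma> permutes ?I. signof \<sigma> *
      (\<Prod>i\<in>?I. \<Sum>e\<in>out_arcs G (block n i). x e * F e i (\<sigma> i)))"
    by (rule leibniz_row_expansion) (auto intro: finite_out_arcs)
  also have "\<dots> = (\<Sum>\<sigma> | \<sigma> permutes ?I. signof \<sigma> * (\<Prod>i\<in>?I. L (?\<phi> i) (?\<phi> (\<sigma> i))))"
  proof (intro sum.cong[OF refl] arg_cong2[of _ _ _ _ "(*)"] refl prod.cong)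
    fix \<sigma> i assume "\<sigma> \<in> {\<sigma>. \<sigma> permutes ?I}" "i \<in> ?I"
    then show "(\<Sum>e\<in>out_arcs G (block n i). x e * F e i (\<sigma> i)) = L (?\<phi> i) (?\<phi> (\<sigma> i))"
      using permutes_in_image[of \<sigma> ?I i] by (subst entry) auto
  qed
  also have "\<dots> = det_endo p n (twisted_laplacian G n x U)"
    unfolding det_endo_def L_def
    by (subst det_mat_reindex[OF _ bij_betw_placement[OF \<rho>]]) simp_all
  finally show ?thesis by simp
qed

lemma holonomy_eq_path_mat:
  "holonomy n U \<xi> c = path_mat (\<lambda>i. U (\<xi> i)) (n (block n (hd c))) c"
  by (simp add: holonomy_def path_mat_def)

theorem theorem1p7:
  fixes G :: "(nat, 'e) pre_digraph"
    and p :: nat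
    and n :: "nat \<Rightarrow> nat"
    and x :: "'e \<Rightarrow> complex"
    and U :: "'e \<Rightarrow> complex mat"
  assumes "fin_digraph G"
    and "loopfree_digraph G"
    and "verts G = {1..p}"
    and "\<And>v. v \<in> verts G \<Longrightarrow> n v \<ge> 1"
    and "\<And>e. e \<in> arcs G \<Longrightarrow> U e \<in> carrier_mat (n (tail G e)) (n (head G e))"
  shows "det_endo p n (twisted_laplacian G n x U) =
    1 / (\<Prod>a=1..p. fact (n a)) *
    (\<Sum>\<xi>\<in>arc_choices G p n.
      (\<Prod>i=1..total_dim p n. x (\<xi> i)) *
      (\<Sum>\<sigma>\<in>compatible_perms G p n \<xi>.
        (\<Prod>a=1..p. fact (n a - visits n \<sigma> a)) *
        (\<Prod>c\<in>nontrivial_cycles \<sigma>. - mat_trace (holonomy n U \<xi> c))))"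
proof -
  let ?I = "{1..total_dim p n}" and ?b = "block n"
  let ?R = "placements ?I ?b n"
  let ?det = "det_endo p n (twisted_laplacian G n x U)"
  have nl: "tail G e \<noteq> head G e" if "e \<in> arcs G" for e
    using loopfree_digraph.no_loops[OF assms(2) that] .
  have bI: "?b ` ?I \<subseteq> {1..p}"
    using block_mem by blast
  have full: "card {i\<in>?I. ?b i = a} = n a" if "a \<in> {1..p}" for a
    unfolding block_fibre[OF that] by (simp add: interval_def)
  \<comment> \<open>Rewriting the bracket for each \<open>\<xi>\<close> separately lets the sums over \<open>\<xi>\<close> and \<open>\<rho>\<close> be exchanged.\<close>
  have bracket: "(\<Sum>\<sigma>\<in>compatible_perms G p n \<xi>. (\<Prod>a=1..p. fact (n a - visits n \<sigma> a)) *
        (\<Prod>c\<in>nontrivial_cycles \<sigma>. - mat_trace (holonomy n U \<xi> c))) =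
      (\<Sum>\<rho>\<in>?R. \<Sum>\<sigma>\<in>compatible_perms G p n \<xi>. perm_weight (\<lambda>i. U (\<xi> i)) \<rho> \<sigma>)"
    if \<xi>: "\<xi> \<in> arc_choices G p n" for \<xi>
  proof -
    let ?h = "\<lambda>i. head G (\<xi> i)" and ?V = "\<lambda>i. U (\<xi> i)"
    have arc: "\<xi> i \<in> arcs G" "tail G (\<xi> i) = ?b i" if "i \<in> ?I" for i
      using PiE_mem[OF \<xi>[unfolded arc_choices_def] that] by auto
    have compat: "compatible_perms G p n \<xi> = compat_perms ?I ?b ?h"
      by (simp add: compatible_perms_def compat_perms_def)
    have "(\<Prod>a=1..p. fact (n a - visits n \<sigma> a)) *
          (\<Prod>c\<in>nontrivial_cycles \<sigma>. - mat_trace (holonomy n U \<xi> c)) =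
        (\<Prod>a=1..p. fact (n a - card {i\<in>moved \<sigma>. ?b i = a})) *
          (\<Sum>g\<in>(\<Pi>\<^sub>E i\<in>moved \<sigma>. {..<n (?b i)}). perm_weight ?V g \<sigma>)"
      if \<sigma>: "\<sigma> \<in> compat_perms ?I ?b ?h" for \<sigma>
    proof -
      have s: "\<sigma> permutes ?I" "\<And>i. i \<in> ?I \<Longrightarrow> \<sigma> i = i \<or> ?h i = ?b (\<sigma> i)"
        using \<sigma> by (auto simp: compat_perms_def)
      have perm: "permutation \<sigma>"
        using s(1) permutation_permutes by blast
      have "{i \<in> interval n a. \<sigma> i \<noteq> i} = {i\<in>moved \<sigma>. ?b i = a}" if "a \<in> {1..p}" for a
        using moved_subset[OF s(1)] unfolding block_fibre[OF that, symmetric] moved_def by blast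
      then have "visits n \<sigma> a = card {i\<in>moved \<sigma>. ?b i = a}" if "a \<in> {1..p}" for a
        using that by (simp add: visits_def)
      moreover have "U (\<xi> i) \<in> carrier_mat (n (?b i)) (n (?b (\<sigma> i)))" if "i \<in> moved \<sigma>" for i
      proof -
        have "i \<in> ?I" using that moved_subset[OF s(1)] by blast
        then show ?thesis
          using assms(5)[OF arc(1)] arc(2) s(2) that by (force simp: moved_def)
      qed
      then have "(\<Prod>c\<in>nontrivial_cycles \<sigma>. - mat_trace (holonomy n U \<xi> c)) =
          (\<Sum>g\<in>(\<Pi>\<^sub>E i\<in>moved \<sigma>. {..<n (?b i)}). perm_weight ?V g \<sigma>)"
        unfolding holonomy_eq_path_mat by (intro prod_cycle_traces[OF perm]) auto
      ultimately show ?thesis by simp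
    qed
    then have "(\<Sum>\<sigma>\<in>compat_perms ?I ?b ?h. (\<Prod>a=1..p. fact (n a - visits n \<sigma> a)) *
          (\<Prod>c\<in>nontrivial_cycles \<sigma>. - mat_trace (holonomy n U \<xi> c))) =
        (\<Sum>\<sigma>\<in>compat_perms ?I ?b ?h. (\<Prod>a=1..p. fact (n a - card {i\<in>moved \<sigma>. ?b i = a})) *
          (\<Sum>g\<in>(\<Pi>\<^sub>E i\<in>moved \<sigma>. {..<n (?b i)}). perm_weight ?V g \<sigma>))"
      by (rule sum.cong[OF refl])
    also have "\<dots> = (\<Sum>\<rho>\<in>?R. \<Sum>\<sigma>\<in>compat_perms ?I ?b ?h. perm_weight ?V \<rho> \<sigma>)"
    proof (rule sum_weighted_eq_sum_placements[OF _ _ bI full])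
      show "?h i \<noteq> ?b i" if "i \<in> ?I" for i
        using arc[OF that] nl by metis
    qed auto
    finally show ?thesis
      unfolding compat .
  qed
  have "(\<Sum>\<xi>\<in>arc_choices G p n. (\<Prod>i=1..total_dim p n. x (\<xi> i)) *
      (\<Sum>\<sigma>\<in>compatible_perms G p n \<xi>. (\<Prod>a=1..p. fact (n a - visits n \<sigma> a)) *
        (\<Prod>c\<in>nontrivial_cycles \<sigma>. - mat_trace (holonomy n U \<xi> c)))) =
      (\<Sum>\<rho>\<in>?R. \<Sum>\<xi>\<in>arc_choices G p n. (\<Prod>i=1..total_dim p n. x (\<xi> i)) *
        (\<Sum>\<sigma>\<in>compatible_perms G p n \<xi>. perm_weight (\<lambda>i. U (\<xi> i)) \<rho> \<sigma>))"
    by (subst sum.swap, rule sum.cong[OF refl]) (simp only: bracket sum_distrib_left)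
  also have "\<dots> = (\<Sum>\<rho>\<in>?R. ?det)"
    using det_endo_laplacian_placement[OF assms(1,5) nl] by simp
  also have "\<dots> = (\<Prod>a=1..p. fact (n a)) * ?det"
    using card_placements[OF _ _ bI full] by simp
  \<comment> \<open>The sum is the number of placements times the determinant.\<close>
  finally show ?thesis by simp
qed

end
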